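(* Let $n\geq m\geq 2$ be integers. The number of $\alpha\in\mathcal{DDP}_n$ with $f(\alpha)=m$ is $\binom{n}{m}$.
   Context: $X_n=\{1,2,\ldots,n\}$ and $\mathcal{I}_n$ is the symmetric inverse semigroup of all partial one-to-one maps of $X_n$ (including the empty map), with maps written on the right of their arguments. A map $\alpha\in\mathcal{I}_n$ is a partial isometry if $|x-y|=|x\alpha-y\alpha|$ for all $x,y\in\operatorname{Dom}\alpha$; it is order-decreasing if $x\alpha\leq x$ for all $x\in\operatorname{Dom}\alpha$. $\mathcal{DDP}_n$ is the semigroup of all order-decreasing partial isometries of $X_n$. The fix of $\alpha$ is $f(\alpha)=|\{x\in\operatorname{Dom}\alpha: x\alpha=x\}|$. *)

theory Defs
  imports Main
begin

definition X :: "nat \<Rightarrow> nat set" where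
  "X n = {1..n}"

text \<open>Partial maps of \<^term>\<open>X n\<close> are elements of \<^typ>\<open>nat \<rightharpoonup> nat\<close> that are undefined outside \<^term>\<open>X n\<close>;
  \<^term>\<open>the (\<alpha> x)\<close> is the image of a point \<^term>\<open>x \<in> dom \<alpha>\<close>.\<close>

definition sym_inv_semigroup :: "nat \<Rightarrow> (nat \<rightharpoonup> nat) set" where
  "sym_inv_semigroup n = {\<alpha>. dom \<alpha> \<subseteq> X n \<and> ran \<alpha> \<subseteq> X n \<and> inj_on \<alpha> (dom \<alpha>)}"

text \<open>The distance is taken in \<^typ>\<open>int\<close>, since subtraction on \<^typ>\<open>nat\<close> is truncated.\<close>

definition partial_isometry :: "(nat \<rightharpoonup> nat) \<Rightarrow> bool" where
  "partial_isometry \<alpha> \<longleftrightarrow>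
     (\<forall>x\<in>dom \<alpha>. \<forall>y\<in>dom \<alpha>. \<bar>int x - int y\<bar> = \<bar>int (the (\<alpha> x)) - int (the (\<alpha> y))\<bar>)"

definition order_decreasing :: "(nat \<rightharpoonup> nat) \<Rightarrow> bool" where
  "order_decreasing \<alpha> \<longleftrightarrow> (\<forall>x\<in>dom \<alpha>. the (\<alpha> x) \<le> x)"

definition DDP :: "nat \<Rightarrow> (nat \<rightharpoonup> nat) set" where
  "DDP n = {\<alpha> \<in> sym_inv_semigroup n. partial_isometry \<alpha> \<and> order_decreasing \<alpha>}"

definition fix_count :: "(nat \<rightharpoonup> nat) \<Rightarrow> nat" where
  "fix_count \<alpha> = card {x \<in> dom \<alpha>. the (\<alpha> x) = x}"

end

theory Submission
  imports Defs
begin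

text \<open>
  A point of the line is determined by its distances to two distinct points. Hence a partial
  isometry with two fixed points fixes every point of its domain, so it is the identity map of
  that domain. Conversely, the identity map of any subset of \<^term>\<open>X n\<close> is an order-decreasing
  partial isometry, and it fixes its whole domain. So the maps with \<open>m \<ge> 2\<close> fixed points
  correspond to the \<open>m\<close>-element subsets of \<^term>\<open>X n\<close>.
\<close>

definition partial_id :: "'a set \<Rightarrow> ('a \<rightharpoonup> 'a)" where
  "partial_id A = Some |` A"

lemma partial_id_apply: "partial_id A x = (if x \<in> A then Some x else None)"
  by (simp add: partial_id_def)

lemma dom_partial_id [simp]: "dom (partial_id A) = A"
  by (auto simp: partial_id_apply split: if_splits)

lemma ran_partial_id [simp]: "ran (partial_id A) = A"
  by (auto simp: partial_id_apply ran_def)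

lemma the_partial_id [simp]: "x \<in> A \<Longrightarrow> the (partial_id A x) = x"
  by (simp add: partial_id_apply)

lemma inj_partial_id: "inj partial_id"
  by (metis dom_partial_id injI)

lemma partial_id_in_DDP: "A \<subseteq> X n \<Longrightarrow> partial_id A \<in> DDP n"
  by (auto simp: DDP_def sym_inv_semigroup_def partial_isometry_def order_decreasing_def
      inj_on_def partial_id_apply)

lemma fix_count_partial_id: "fix_count (partial_id A) = card A"
  by (auto simp: fix_count_def intro: arg_cong [where f = card])

text \<open>
  If the image \<open>y\<close> of \<open>x\<close> has the same distances to the fixed points \<open>a\<close> and \<open>b\<close> as \<open>x\<close> has,
  then \<open>y \<noteq> x\<close> would make both \<open>a\<close> and \<open>b\<close> the midpoint of \<open>x\<close> and \<open>y\<close>.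
\<close>

lemma partial_isometry_two_fixed_points:
  assumes iso: "partial_isometry \<alpha>"
    and a: "a \<in> dom \<alpha>" "the (\<alpha> a) = a"
    and b: "b \<in> dom \<alpha>" "the (\<alpha> b) = b"
    and "a \<noteq> b"
  shows "\<alpha> = partial_id (dom \<alpha>)"
proof
  fix x
  show "\<alpha> x = partial_id (dom \<alpha>) x"
  proof (cases "x \<in> dom \<alpha>")
    case True
    have "\<bar>int x - int a\<bar> = \<bar>int (the (\<alpha> x)) - int a\<bar>"
      using iso True a unfolding partial_isometry_def by metis
    moreover have "\<bar>int x - int b\<bar> = \<bar>int (the (\<alpha> x)) - int b\<bar>"
      using iso True b unfolding partial_isometry_def by metis
    ultimately have "the (\<alpha> x) = x"
      using \<open>a \<noteq> b\<close> by linarith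
    with True show ?thesis
      by (auto simp: partial_id_apply)
  qed (auto simp: partial_id_apply)
qed

lemma DDP_fix_count_eq_image:
  assumes "m \<ge> 2"
  shows "{\<alpha> \<in> DDP n. fix_count \<alpha> = m} = partial_id ` {A. A \<subseteq> X n \<and> card A = m}"
proof
  show "{\<alpha> \<in> DDP n. fix_count \<alpha> = m} \<subseteq> partial_id ` {A. A \<subseteq> X n \<and> card A = m}"
  proof
    fix \<alpha> assume "\<alpha> \<in> {\<alpha> \<in> DDP n. fix_count \<alpha> = m}"
    then have ddp: "\<alpha> \<in> DDP n" and fix_m: "fix_count \<alpha> = m"
      by auto
    have "\<not> card {x \<in> dom \<alpha>. the (\<alpha> x) = x} \<le> Suc 0"
      using fix_m assms by (simp add: fix_count_def)
    then obtain a b where "a \<in> dom \<alpha>" "the (\<alpha> a) = a" "b \<in> dom \<alpha>" "the (\<alpha> b) = b" "a \<noteq> b"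
      by (metis (mono_tags, lifting) card.infinite card_le_Suc0_iff_eq le0 mem_Collect_eq)
    then have \<alpha>: "\<alpha> = partial_id (dom \<alpha>)"
      using ddp by (intro partial_isometry_two_fixed_points) (auto simp: DDP_def)
    moreover have "dom \<alpha> \<subseteq> X n"
      using ddp by (simp add: DDP_def sym_inv_semigroup_def)
    moreover have "card (dom \<alpha>) = m"
      using \<alpha> fix_m fix_count_partial_id by metis
    ultimately show "\<alpha> \<in> partial_id ` {A. A \<subseteq> X n \<and> card A = m}"
      by blast
  qed
  show "partial_id ` {A. A \<subseteq> X n \<and> card A = m} \<subseteq> {\<alpha> \<in> DDP n. fix_count \<alpha> = m}"
    by (auto simp: partial_id_in_DDP fix_count_partial_id)
qed

theorem lemma2p18:
  fixes n m :: nat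
  assumes "n \<ge> m" and "m \<ge> 2"
  shows "card {\<alpha> \<in> DDP n. fix_count \<alpha> = m} = n choose m"
proof -
  have "card {\<alpha> \<in> DDP n. fix_count \<alpha> = m} = card {A. A \<subseteq> X n \<and> card A = m}"
    unfolding DDP_fix_count_eq_image [OF \<open>m \<ge> 2\<close>]
    by (rule card_image) (rule inj_on_subset [OF inj_partial_id subset_UNIV])
  also have "\<dots> = n choose m"
    by (simp add: n_subsets X_def)
  finally show ?thesis .
qed

end
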